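(* Let $X$ be a real normed space with $\dim X\ge 2$ and let $\lambda\in\Lambda_m$. If $1\le p<\infty$, then $$2^{1/2-1/p}\le \mathfrak{C}'_{\lambda,p}(X)\le \mathfrak{C}_{\lambda,p}(X)\le 2^{1-1/p}.$$ For $p=\infty$, $$\sqrt2\le \mathfrak{C}'_{\lambda,\infty}(X)\le \mathfrak{C}_{\lambda,\infty}(X)\le 2.$$
   Context: $\Lambda$ is the class of all continuous functions $\lambda:[0,\infty)^2\to[0,\infty)$ that are homogeneous of degree one and satisfy $\lambda(1,1)=1$. $\Lambda_m$ is the set of $\lambda\in\Lambda$ that are non-decreasing in each variable. $S_X$ is the unit sphere of $X$. For $(r,s)\in\mathbb{R}^2$, $\|(r,s)\|_p=(|r|^p+|s|^p)^{1/p}$ if $1\le p<\infty$ and $\|(r,s)\|_\infty=\max\{|r|,|s|\}$. For $\lambda\in\Lambda$ and $p\in[1,\infty]$, $$\mathfrak{C}_{\lambda,p}(X)=\sup\{\lambda(\|ru+sv\|,\|su-rv\|):u,v\in S_X,\ r,s\ge0,\ \|(r,s)\|_p=1\},$$ $$\mathfrak{C}'_{\lambda,p}(X)=\sup\{2^{-1/p}\lambda(\|u+v\|,\|u-v\|):u,v\in S_X\},$$ where $2^{1/\infty}=1$. *)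

theory Defs
  imports "HOL-Analysis.Analysis"
begin

text \<open>
  A function on the closed quadrant is represented by a total function on pairs of reals;
  its values outside the quadrant are unconstrained and never used.
\<close>

definition Lambda :: "(real \<times> real \<Rightarrow> real) set" where
  "Lambda = {l. continuous_on ({0..} \<times> {0..}) l \<and>
                (\<forall>a\<ge>0. \<forall>b\<ge>0. 0 \<le> l (a, b)) \<and>
                (\<forall>t\<ge>0. \<forall>a\<ge>0. \<forall>b\<ge>0. l (t * a, t * b) = t * l (a, b)) \<and>
                l (1, 1) = 1}"

definition Lambda_m :: "(real \<times> real \<Rightarrow> real) set" where
  "Lambda_m = {l \<in> Lambda. (\<forall>b\<ge>0. mono_on {0..} (\<lambda>a. l (a, b))) \<and>
                           (\<forall>a\<ge>0. mono_on {0..} (\<lambda>b. l (a, b)))}"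

text \<open>The exponent \<open>p\<close> ranges over the extended reals, with \<open>1 \<le> p \<le> \<infinity>\<close> intended.\<close>

definition pnorm :: "ereal \<Rightarrow> real \<Rightarrow> real \<Rightarrow> real" where
  "pnorm p r s =
     (if p = \<infinity> then max \<bar>r\<bar> \<bar>s\<bar>
      else (\<bar>r\<bar> powr real_of_ereal p + \<bar>s\<bar> powr real_of_ereal p) powr (1 / real_of_ereal p))"

text \<open>
  The suprema are taken in \<^typ>\<open>ereal\<close>, where they are genuine suprema without any
  boundedness side condition.
\<close>

definition C_const :: "'a::real_normed_vector itself \<Rightarrow> (real \<times> real \<Rightarrow> real) \<Rightarrow> ereal \<Rightarrow> ereal" where
  "C_const X l p =
     Sup {ereal (l (norm (r *\<^sub>R u + s *\<^sub>R v), norm (s *\<^sub>R u - r *\<^sub>R v))) | (u::'a) v r s.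
            u \<in> sphere 0 1 \<and> v \<in> sphere 0 1 \<and> 0 \<le> r \<and> 0 \<le> s \<and> pnorm p r s = 1}"

definition C'_const :: "'a::real_normed_vector itself \<Rightarrow> (real \<times> real \<Rightarrow> real) \<Rightarrow> ereal \<Rightarrow> ereal" where
  "C'_const X l p =
     Sup {ereal ((if p = \<infinity> then 1 else 2 powr (- (1 / real_of_ereal p))) *
                 l (norm (u + v), norm (u - v))) | (u::'a) v.
            u \<in> sphere 0 1 \<and> v \<in> sphere 0 1}"

text \<open>
  \<^term>\<open>dim (UNIV :: 'a::real_vector set)\<close> is 0 when the space is infinite-dimensional, so it
  cannot be used to express that the dimension is at least 2.
\<close>

definition dim_ge_2 :: "'a::real_vector itself \<Rightarrow> bool" where
  "dim_ge_2 X \<longleftrightarrow> (\<exists>B :: 'a set. independent B \<and> card B = 2)"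

end

theory Submission
  imports Defs
begin

text \<open>
  A function in \<^const>\<open>Lambda_m\<close> lies between the minimum and the maximum of its arguments, so the upper
  bound reduces to \<open>r + s \<le> 2 powr (1 - 1/p)\<close>, and the lower bound to finding unit vectors with
  \<open>norm (u + v) = norm (u - v) \<ge> sqrt 2\<close>. Moving \<open>v\<close> along a half circle from \<open>u\<close> to \<open>- u\<close> in a plane
  gives \<open>norm (u + v) = norm (u - v) = a\<close> for some \<open>v\<close>. If \<open>a < sqrt 2\<close>, the unit vectors
  \<open>(u + v) / a\<close> and \<open>(u - v) / a\<close> have sum and difference of norm \<open>2 / a > sqrt 2\<close>.
\<close>

text \<open>Homogeneity and \<open>l (1, 1) = 1\<close> give \<open>l (t, t) = t\<close>.
  Monotonicity in each variable then compares \<open>(a, b)\<close> with the diagonal points at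
  \<open>min a b\<close> and \<open>max a b\<close>.\<close>

lemma Lambda_m_bounds:
  assumes l: "l \<in> Lambda_m" and "0 \<le> a" "0 \<le> b"
  shows "min a b \<le> l (a, b)" and "l (a, b) \<le> max a b"
proof -
  have diag: "l (t, t) = t" if "0 \<le> t" for t
  proof -
    have "\<forall>t\<ge>0. \<forall>a\<ge>0. \<forall>b\<ge>0. l (t * a, t * b) = t * l (a, b)" "l (1, 1) = 1"
      using l by (auto simp: Lambda_m_def Lambda_def)
    from this(1)[rule_format, of t 1 1] this(2) that show ?thesis by simp
  qed
  have mono: "l (c, d) \<le> l (c', d')" if "0 \<le> c" "c \<le> c'" "0 \<le> d" "d \<le> d'" for c d c' d'
  proof -
    have "mono_on {0..} (\<lambda>x. l (x, d))" "mono_on {0..} (\<lambda>y. l (c', y))"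
      using l that by (auto simp: Lambda_m_def)
    from mono_onD[OF this(1), of c c'] mono_onD[OF this(2), of d d'] that
    show ?thesis by simp
  qed
  show "min a b \<le> l (a, b)"
    using mono[of "min a b" a "min a b" b] diag[of "min a b"] assms(2,3) by simp
  show "l (a, b) \<le> max a b"
    using mono[of a "max a b" b "max a b"] diag[of "max a b"] assms(2,3) by simp
qed

lemma Lambda_m_scale:
  assumes "l \<in> Lambda_m" "0 \<le> t" "0 \<le> a" "0 \<le> b"
  shows "l (t * a, t * b) = t * l (a, b)"
  using assms by (auto simp: Lambda_m_def Lambda_def)

lemma unit_isosceles_orthogonal:
  assumes "dim_ge_2 TYPE('a::real_normed_vector)"
  obtains u v :: "'a::real_normed_vector" where "norm u = 1" "norm v = 1" "norm (u + v) = norm (u - v)"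
proof -
  obtain x y :: 'a where xy: "independent {x, y}" "x \<noteq> y"
    using assms by (auto simp: dim_ge_2_def card_2_iff)
  then have "x \<noteq> 0"
    using dependent_zero[of "{x, y}"] by auto
  define w where "w t = cos t *\<^sub>R x + sin t *\<^sub>R y" for t
  \<comment> \<open>Independence keeps the path away from the origin, so \<open>sgn (w t)\<close> is
    a continuous path of unit vectors.\<close>
  have w0: "w t \<noteq> 0" for t
  proof
    assume "w t = 0"
    then have "(\<Sum>z\<in>{x, y}. (if z = x then cos t else sin t) *\<^sub>R z) = 0"
      using xy by (simp add: w_def)
    then have "z \<in> {x, y} \<Longrightarrow> (if z = x then cos t else sin t) = 0" for z
      using independentD[OF xy(1), of "{x, y}" "\<lambda>z. if z = x then cos t else sin t"] by blast
    from this[of x] this[of y] have "cos t = 0" "sin t = 0"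
      using xy by auto
    then show False
      using sin_cos_squared_add[of t] by simp
  qed
  define g where "g t = norm (sgn x + sgn (w t)) - norm (sgn x - sgn (w t))" for t
  have "continuous_on {0..pi} g"
    unfolding g_def sgn_div_norm using w0 \<open>x \<noteq> 0\<close> unfolding w_def
    by (intro continuous_intros) auto
  \<comment> \<open>The path starts at \<open>w 0 = x\<close> and ends at \<open>w pi = - x\<close>,
    so \<open>g\<close> runs from 2 to -2 and must vanish in between.\<close>
  moreover have "g pi \<le> 0" "0 \<le> g 0"
    using \<open>x \<noteq> 0\<close> by (simp_all add: g_def w_def sgn_minus)
  ultimately obtain t where "g t = 0"
    using IVT2'[of g pi 0 0] by auto
  then show ?thesis
    using that[of "sgn x" "sgn (w t)"] w0 \<open>x \<noteq> 0\<close> by (simp add: g_def norm_sgn)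
qed

lemma unit_sum_diff_ge_sqrt2:
  assumes "dim_ge_2 TYPE('a::real_normed_vector)"
  obtains u v :: "'a::real_normed_vector" where "norm u = 1" "norm v = 1"
    "sqrt 2 \<le> norm (u + v)" "sqrt 2 \<le> norm (u - v)"
proof -
  obtain u v :: 'a where uv: "norm u = 1" "norm v = 1" "norm (u + v) = norm (u - v)"
    using unit_isosceles_orthogonal[OF assms] .
  define a where "a = norm (u + v)"
  show ?thesis
  proof (cases "sqrt 2 \<le> a")
    case True
    then show ?thesis using that[of u v] uv by (simp add: a_def)
  next
    case False
    \<comment> \<open>The left side is \<open>norm (2 *\<^sub>R u) = 2\<close>, hence
      \<open>a\<close> is at least 1 and division by it is safe.\<close>
    have "norm ((u + v) + (u - v)) \<le> a + a"
      using norm_triangle_ineq[of "u + v" "u - v"] uv by (simp add: a_def)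
    moreover have "(u + v) + (u - v) = 2 *\<^sub>R u" "(u + v) - (u - v) = 2 *\<^sub>R v"
      by (simp_all add: scaleR_2)
    ultimately have "1 \<le> a" using uv by simp
    define u' v' where "u' = (1 / a) *\<^sub>R (u + v)" and "v' = (1 / a) *\<^sub>R (u - v)"
    have "u' + v' = (2 / a) *\<^sub>R u" "u' - v' = (2 / a) *\<^sub>R v"
      by (simp_all add: u'_def v'_def algebra_simps flip: scaleR_left_distrib)
    then have "norm (u' + v') = 2 / a" "norm (u' - v') = 2 / a"
      using uv \<open>1 \<le> a\<close> by simp_all
    moreover have "sqrt 2 \<le> 2 / a"
    proof -
      have "sqrt 2 * a \<le> sqrt 2 * sqrt 2"
        using False by (intro mult_left_mono) auto
      then show ?thesis using \<open>1 \<le> a\<close> by (simp add: field_simps)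
    qed
    moreover have "norm u' = 1" "norm v' = 1"
      unfolding u'_def v'_def norm_scaleR uv(3)[symmetric] a_def[symmetric]
      using \<open>1 \<le> a\<close> by simp_all
    ultimately show ?thesis by (intro that[of u' v']) simp_all
  qed
qed

text \<open>A single pair of unit vectors with sum and difference both of norm at least
  \<open>sqrt 2\<close> suffices, because \<open>l\<close> is at least the minimum of its arguments.
  The conditional factor treats finite and infinite \<open>p\<close> together.\<close>

lemma C'_const_ge:
  assumes "dim_ge_2 TYPE('a::real_normed_vector)" and l: "l \<in> Lambda_m"
  shows "ereal ((if p = \<infinity> then 1 else 2 powr (- (1 / real_of_ereal p))) * sqrt 2)
           \<le> C'_const TYPE('a) l p"
proof -
  obtain u v :: 'a where uv: "norm u = 1" "norm v = 1"
    "sqrt 2 \<le> norm (u + v)" "sqrt 2 \<le> norm (u - v)"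
    using unit_sum_diff_ge_sqrt2[OF assms(1)] .
  have "sqrt 2 \<le> l (norm (u + v), norm (u - v))"
    using Lambda_m_bounds(1)[OF l, of "norm (u + v)" "norm (u - v)"] uv by auto
  then have "ereal ((if p = \<infinity> then 1 else 2 powr (- (1 / real_of_ereal p))) * sqrt 2)
      \<le> ereal ((if p = \<infinity> then 1 else 2 powr (- (1 / real_of_ereal p)))
          * l (norm (u + v), norm (u - v)))"
    unfolding ereal_less_eq by (intro mult_left_mono) auto
  also have "\<dots> \<le> C'_const TYPE('a) l p"
    unfolding C'_const_def using uv by (intro Sup_upper) auto
  finally show ?thesis .
qed

text \<open>Homogeneity moves the factor \<open>c\<close> inside \<open>l\<close>, which turns each
  value in the first supremum into the value of the second at \<open>r = s = c\<close>.\<close>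

lemma C'_const_le_C_const:
  assumes l: "l \<in> Lambda_m" and c: "0 \<le> c" "pnorm p c c = 1"
    and c_eq: "c = (if p = \<infinity> then 1 else 2 powr (- (1 / real_of_ereal p)))"
  shows "C'_const TYPE('a::real_normed_vector) l p \<le> C_const TYPE('a) l p"
  unfolding C'_const_def c_eq[symmetric]
proof (rule Sup_least, clarify)
  fix u v :: 'a
  assume uv: "u \<in> sphere 0 1" "v \<in> sphere 0 1"
  have "c * l (norm (u + v), norm (u - v)) = l (c * norm (u + v), c * norm (u - v))"
    using Lambda_m_scale[OF l c(1)] by simp
  also have "\<dots> = l (norm (c *\<^sub>R u + c *\<^sub>R v), norm (c *\<^sub>R u - c *\<^sub>R v))"
    using c by (simp flip: scaleR_right_distrib scaleR_right_diff_distrib)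
  also have "ereal \<dots> \<le> C_const TYPE('a) l p"
    unfolding C_const_def using uv c by (intro Sup_upper) blast
  finally show "ereal (c * l (norm (u + v), norm (u - v))) \<le> C_const TYPE('a) l p" .
qed

text \<open>By the triangle inequality both norms are at most \<open>r + s\<close>, and
  \<open>l\<close> is at most the maximum of its arguments. Only a bound for \<open>r + s\<close> on
  the unit sphere of \<open>pnorm p\<close> remains to be supplied.\<close>

lemma C_const_le:
  assumes l: "l \<in> Lambda_m"
    and K: "\<And>r s. 0 \<le> r \<Longrightarrow> 0 \<le> s \<Longrightarrow> pnorm p r s = 1 \<Longrightarrow> r + s \<le> K"
  shows "C_const TYPE('a::real_normed_vector) l p \<le> ereal K"
  unfolding C_const_def
proof (rule Sup_least, clarify)
  fix u v :: 'a and r s :: real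
  assume A: "u \<in> sphere 0 1" "v \<in> sphere 0 1" "0 \<le> r" "0 \<le> s" "pnorm p r s = 1"
  have "norm (r *\<^sub>R u + s *\<^sub>R v) \<le> r + s" "norm (s *\<^sub>R u - r *\<^sub>R v) \<le> r + s"
    using norm_triangle_ineq[of "r *\<^sub>R u" "s *\<^sub>R v"]
      norm_triangle_ineq4[of "s *\<^sub>R u" "r *\<^sub>R v"] A by auto
  then show "ereal (l (norm (r *\<^sub>R u + s *\<^sub>R v), norm (s *\<^sub>R u - r *\<^sub>R v))) \<le> ereal K"
    using Lambda_m_bounds(2)[OF l, of "norm (r *\<^sub>R u + s *\<^sub>R v)" "norm (s *\<^sub>R u - r *\<^sub>R v)"]
      K[OF A(3-5)] by auto
qed

lemma pnorm_diagonal: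
  assumes "1 \<le> (p::real)"
  shows "pnorm (ereal p) (2 powr (- (1 / p))) (2 powr (- (1 / p))) = 1"
proof -
  have "(2 powr (- (1 / p))) powr p = 2 powr (-1)"
    using assms by (simp only: powr_powr) simp
  then have "2 * (2 powr (- (1 / p))) powr p = 1"
    by (simp add: powr_minus_divide)
  then show ?thesis
    by (simp add: pnorm_def mult.commute)
qed

text \<open>This is the power mean inequality for two numbers, obtained from convexity of
  \<open>x powr p\<close>.\<close>

lemma sum_le_if_pnorm_eq_1:
  assumes "1 \<le> (p::real)" "0 \<le> r" "0 \<le> s" "pnorm (ereal p) r s = 1"
  shows "r + s \<le> 2 powr (1 - 1 / p)"
proof -
  have eq1: "(r powr p + s powr p) powr (1 / p) = 1"
    using assms by (simp add: pnorm_def)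
  have "r powr p + s powr p = ((r powr p + s powr p) powr (1 / p)) powr p"
    using assms by (simp add: powr_powr)
  then have rs: "r powr p + s powr p = 1"
    by (simp add: eq1)
  show ?thesis
  \<comment> \<open>On the axes the sum is exactly 1 and the exponent \<open>1 - 1 / p\<close> is
    nonnegative; convexity is applied to positive \<open>r\<close> and \<open>s\<close>
    only.\<close>
  proof (cases "r = 0 \<or> s = 0")
    case True
    then have "(r + s) powr p = 1"
      using rs assms by auto
    then have "((r + s) powr p) powr (1 / p) = 1"
      by simp
    then have "r + s = 1"
      using assms by (simp add: powr_powr)
    then show ?thesis
      using assms by (simp add: ge_one_powr_ge_zero)
  next
    case False
    \<comment> \<open>Convexity at the midpoint, with the weights written in the form expected by
      \<open>convex_onD\<close>.\<close>
    have "((1 - 1 / 2) *\<^sub>R r + (1 / 2) *\<^sub>R s) powr p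
        \<le> (1 - 1 / 2) * r powr p + (1 / 2) * s powr p"
      using assms False by (intro convex_onD[OF powr_convex]) auto
    then have "((r + s) / 2) powr p \<le> 1 / 2"
      using rs by (simp add: field_simps)
    then have "(((r + s) / 2) powr p) powr (1 / p) \<le> (1 / 2) powr (1 / p)"
      using assms by (intro powr_mono2) auto
    then have "(r + s) / 2 \<le> (1 / 2) powr (1 / p)"
      using assms by (simp add: powr_powr)
    then show ?thesis
      by (simp add: powr_diff powr_divide field_simps)
  qed
qed

theorem theorem6:
  fixes l :: "real \<times> real \<Rightarrow> real"
  assumes "dim_ge_2 TYPE('a::real_normed_vector)"
    and "l \<in> Lambda_m"
  shows "(\<forall>p::real. 1 \<le> p \<longrightarrow>
            ereal (2 powr (1/2 - 1/p)) \<le> C'_const TYPE('a) l (ereal p) \<and>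
            C'_const TYPE('a) l (ereal p) \<le> C_const TYPE('a) l (ereal p) \<and>
            C_const TYPE('a) l (ereal p) \<le> ereal (2 powr (1 - 1/p))) \<and>
         (ereal (sqrt 2) \<le> C'_const TYPE('a) l \<infinity> \<and>
          C'_const TYPE('a) l \<infinity> \<le> C_const TYPE('a) l \<infinity> \<and>
          C_const TYPE('a) l \<infinity> \<le> 2)"
proof (intro conjI allI impI)
  fix p :: real
  assume p: "1 \<le> p"
  have "2 powr (- (1 / p)) * sqrt 2 = 2 powr (1/2 - 1/p)"
    unfolding powr_half_sqrt[of 2, symmetric, simplified] powr_add[symmetric] by simp
  then show "ereal (2 powr (1/2 - 1/p)) \<le> C'_const TYPE('a) l (ereal p)"
    using C'_const_ge[OF assms, of "ereal p"] by simp
  show "C'_const TYPE('a) l (ereal p) \<le> C_const TYPE('a) l (ereal p)"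
    by (rule C'_const_le_C_const[OF assms(2) _ pnorm_diagonal[OF p]]) simp_all
  show "C_const TYPE('a) l (ereal p) \<le> ereal (2 powr (1 - 1/p))"
    using C_const_le[OF assms(2) sum_le_if_pnorm_eq_1[OF p]] .
next
  show "ereal (sqrt 2) \<le> C'_const TYPE('a) l \<infinity>"
    using C'_const_ge[OF assms, of \<infinity>] by simp
  show "C'_const TYPE('a) l \<infinity> \<le> C_const TYPE('a) l \<infinity>"
    by (rule C'_const_le_C_const[OF assms(2), of 1]) (simp_all add: pnorm_def)
  \<comment> \<open>A maximum equal to 1 bounds each of \<open>r\<close> and \<open>s\<close> by 1,
    hence their sum by 2.\<close>
  have "C_const TYPE('a) l \<infinity> \<le> ereal 2"
    by (rule C_const_le[OF assms(2)]) (auto simp: pnorm_def)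
  then show "C_const TYPE('a) l \<infinity> \<le> 2"
    by simp
qed

end
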